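(* Let $m\ge 1$ and let $1\le q_1<q_2<\cdots<q_m$ be integers. Then for all integers $n\ge 0$ and $k_1,k_2,\ldots,k_m\ge 0$, $$a(n;k_1,k_2,\ldots,k_m)=\sum_{\substack{t_1,t_2,\ldots,t_m\ge 0\\ \sum_{j=1}^m q_jt_j\le n}}(-1)^{\sum_{j=1}^m(k_j+t_j)}\left(\prod_{j=1}^m\binom{t_j}{k_j}\right)\frac{\left(n-\sum_{j=1}^m(q_j-1)t_j\right)!}{\prod_{j=1}^m t_j!},$$ where the sum is over integers $t_1,\ldots,t_m$.
   Context: $S_n$ is the set of all permutations of $[n]=\{1,2,\ldots,n\}$ (with $S_0$ consisting of the single empty permutation). For an integer $q\ge 1$, an adjacent $q$-cycle (A$q$C) of a permutation $\pi\in S_n$ is a cycle of length $q$ in the disjoint cycle decomposition of $\pi$ of the form $(a,a+1,a+2,\ldots,a+q-1)$, i.e. $\pi(a+i)=a+i+1$ for $0\le i\le q-2$ and $\pi(a+q-1)=a$ (for $q=1$ this is a fixed point). For fixed $q_1<\cdots<q_m$, $a(n;k_1,k_2,\ldots,k_m)$ denotes the number of permutations $\pi\in S_n$ having exactly $k_1$ A$q_1$C's, $k_2$ A$q_2$C's, $\ldots$, and $k_m$ A$q_m$C's. As usual, $\binom{t}{k}=0$ when $0\le t<k$. *)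

theory Defs
  imports Complex_Main "HOL-Library.FuncSet" "HOL-Combinatorics.Permutations"
begin

text \<open>Permutations of \<open>[n]\<close> are functions \<open>\<pi>\<close> with \<open>\<pi> permutes {1..n}\<close>.
  Outside \<open>[n]\<close> such a \<open>\<pi>\<close> is the identity, so the bound \<open>a + q - 1 \<le> n\<close> is needed to
  exclude spurious fixed points when \<open>q = 1\<close>.\<close>

definition adjacent_cycle_at :: "nat \<Rightarrow> nat \<Rightarrow> (nat \<Rightarrow> nat) \<Rightarrow> nat \<Rightarrow> bool" where
  "adjacent_cycle_at n q \<pi> a \<longleftrightarrow>
     1 \<le> a \<and> a + q - 1 \<le> n \<and>
     (\<forall>i. i + 2 \<le> q \<longrightarrow> \<pi> (a + i) = a + i + 1) \<and> \<pi> (a + q - 1) = a"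

text \<open>For given \<open>q \<ge> 1\<close>, the cycle \<open>(a, a+1, \<dots>, a+q-1)\<close> is determined by its least
  element \<open>a\<close>, so adjacent \<open>q\<close>-cycles are counted by their starting points.\<close>

definition num_adjacent_cycles :: "nat \<Rightarrow> nat \<Rightarrow> (nat \<Rightarrow> nat) \<Rightarrow> nat" where
  "num_adjacent_cycles n q \<pi> = card {a. adjacent_cycle_at n q \<pi> a}"

text \<open>The number \<open>a(n; k\<^sub>1, \<dots>, k\<^sub>m)\<close>; only the values of \<open>q\<close> and \<open>k\<close> on \<open>{1..m}\<close> matter.\<close>

definition num_perms_adjacent_cycles ::
  "nat \<Rightarrow> (nat \<Rightarrow> nat) \<Rightarrow> nat \<Rightarrow> (nat \<Rightarrow> nat) \<Rightarrow> nat" where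
  "num_perms_adjacent_cycles m q n k =
     card {\<pi>. \<pi> permutes {1..n} \<and> (\<forall>j\<in>{1..m}. num_adjacent_cycles n (q j) \<pi> = k j)}"

text \<open>The tuples \<open>(t\<^sub>1, \<dots>, t\<^sub>m)\<close> of naturals with \<open>q\<^sub>1 t\<^sub>1 + \<dots> + q\<^sub>m t\<^sub>m \<le> n\<close>, represented by
  extensional functions on \<open>{1..m}\<close>, so that each tuple occurs exactly once.\<close>

definition weighted_tuples :: "nat \<Rightarrow> (nat \<Rightarrow> nat) \<Rightarrow> nat \<Rightarrow> (nat \<Rightarrow> nat) set" where
  "weighted_tuples m q n = {t \<in> {1..m} \<rightarrow>\<^sub>E UNIV. (\<Sum>j=1..m. q j * t j) \<le> n}"

text \<open>The sum over these tuples is a genuine finite sum.\<close>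

lemma finite_weighted_tuples:
  assumes "\<And>j. j \<in> {1..m} \<Longrightarrow> 1 \<le> q j"
  shows "finite (weighted_tuples m q n)"
proof (rule finite_subset)
  show "weighted_tuples m q n \<subseteq> {1..m} \<rightarrow>\<^sub>E {..n}"
  proof
    fix t assume t: "t \<in> weighted_tuples m q n"
    have "t j \<le> n" if j: "j \<in> {1..m}" for j
    proof -
      have "t j \<le> q j * t j" using assms[OF j] by simp
      also have "\<dots> \<le> (\<Sum>j=1..m. q j * t j)"
        using j by (intro member_le_sum) auto
      also have "\<dots> \<le> n" using t by (simp add: weighted_tuples_def)
      finally show ?thesis .
    qed
    with t show "t \<in> {1..m} \<rightarrow>\<^sub>E {..n}"
      by (auto simp: weighted_tuples_def PiE_iff)
  qed
qed (simp add: finite_PiE)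

end

theory Submission
  imports Defs
begin

text \<open>
  The formula is an inclusion-exclusion over marked adjacent cycles.  For \<open>\<pi> \<in> S\<^sub>n\<close> let
  \<open>c\<^sub>j(\<pi>)\<close> be its number of adjacent \<open>q\<^sub>j\<close>-cycles.  The condition \<open>c\<^sub>j(\<pi>) = k\<^sub>j\<close> has the
  indicator \<open>\<Sum>t. (-1)\<^bsup>k\<^sub>j + t\<^esup> (t choose k\<^sub>j) (c\<^sub>j(\<pi>) choose t)\<close> (binomial inversion,
  \<open>binomial_inversion_indicator\<close>).  Multiplying over \<open>j\<close>, expanding the product of sums and
  summing over \<open>\<pi>\<close> reduces the theorem to the joint binomial moments
  \<open>\<Sum>\<pi>. \<Prod>j. (c\<^sub>j(\<pi>) choose t\<^sub>j)\<close>, evaluated in \<open>sum_prod_choose_num_adjacent_cycles\<close>.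

  Such a moment counts permutations in which, for each \<open>j\<close>, a set of \<open>t\<^sub>j\<close> adjacent
  \<open>q\<^sub>j\<close>-cycles has been marked.  Distinct cycles of a permutation are disjoint
  (\<open>adjacent_cycle_blocks_disjoint\<close>), so the marks form a placement of disjoint blocks in
  \<open>[n]\<close>, and it is enough to count placements and then the permutations containing a given one.
  \<^item> Let \<open>r = n - \<Sum>j. q\<^sub>j t\<^sub>j\<close> be the number of uncovered points.  A placement is an arrangement
    in a row of \<open>r\<close> single points and \<open>t\<^sub>j\<close> blocks of each type \<open>j\<close>, so there are
    \<open>(r + \<Sum>j. t\<^sub>j)! / (r! \<Prod>j. t\<^sub>j!)\<close> of them (\<open>card_placements\<close>).
  \<^item> A placement prescribes \<open>\<pi>\<close> on the points that it covers and leaves the other \<open>r\<close> points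
    to be permuted freely, in \<open>r!\<close> ways (\<open>card_permutes_containing_placement\<close>).

  The factors \<open>r!\<close> cancel, and \<open>r + \<Sum>j. t\<^sub>j = n - \<Sum>j. (q\<^sub>j - 1) t\<^sub>j\<close>.
\<close>

section \<open>Binomial coefficients\<close>

text \<open>Since \<open>(c choose t) (t choose k) = (c choose k) ((c - k) choose (t - k))\<close>, the sum is
  \<open>(c choose k)\<close> times a full alternating row sum of Pascal's triangle, which vanishes unless the
  row is the one of \<open>c - k = 0\<close>.  The summation bound \<open>n\<close> is independent of \<open>c\<close> so that the same
  range can serve all permutations at once.\<close>

lemma binomial_inversion_indicator:
  fixes n c k :: nat
  assumes "c \<le> n"
  shows "(\<Sum>t\<le>n. (- 1 :: real) ^ (k + t) * real (t choose k) * real (c choose t)) =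
    (if c = k then 1 else 0)"
proof -
  define f where "f t = (- 1 :: real) ^ (k + t) * real (t choose k) * real (c choose t)" for t
  have vanish: "f t = 0" if "t \<notin> {k..c}" for t
    using that by (auto simp: f_def binomial_eq_0)
  have shift: "f (i + k) = real (c choose k) * ((- 1) ^ i * real ((c - k) choose i))"
    if "i + k \<le> c" for i
  proof -
    have "(c choose (i + k)) * ((i + k) choose k) = (c choose k) * ((c - k) choose i)"
      using choose_mult[of k "i + k" c] that by simp
    then have "real (c choose (i + k)) * real ((i + k) choose k) =
        real (c choose k) * real ((c - k) choose i)"
      by (metis of_nat_mult)
    moreover have "(- 1 :: real) ^ (k + (i + k)) = (- 1) ^ i"
      by (simp add: power_add flip: power_mult_distrib)
    ultimately show ?thesis
      by (simp add: f_def mult_ac)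
  qed
  have "(\<Sum>t\<le>n. f t) = (\<Sum>t\<in>{k..c}. f t)"
    using assms vanish by (intro sum.mono_neutral_right) auto
  also have "\<dots> = (if c = k then 1 else 0)"
  proof (cases "k \<le> c")
    case True
    have "(\<Sum>t\<in>{k..c}. f t) = (\<Sum>i\<le>c - k. f (i + k))"
      using True by (intro sum.reindex_bij_witness[of _ "\<lambda>i. i + k" "\<lambda>t. t - k"]) auto
    also have "\<dots> = (\<Sum>i\<le>c - k. real (c choose k) * ((- 1) ^ i * real ((c - k) choose i)))"
      using True by (intro sum.cong) (auto intro: shift)
    also have "\<dots> = real (c choose k) * (\<Sum>i\<le>c - k. (- 1) ^ i * real ((c - k) choose i))"
      by (simp add: sum_distrib_left)
    also have "\<dots> = (if c = k then 1 else 0)"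
      using True choose_alternating_sum[of "c - k", where 'a = real] by auto
    finally show ?thesis .
  qed auto
  finally show ?thesis
    by (simp add: f_def)
qed

text \<open>A choice of a \<open>t j\<close>-element subset of \<open>A j\<close> for each \<open>j\<close> is encoded as a single set of pairs
  with prescribed fibres.  This form allows marks of different types to be treated uniformly and
  to be added or removed one at a time.\<close>

lemma prod_choose_eq_card:
  fixes A :: "'j \<Rightarrow> 'a set"
  assumes "finite J" and "\<And>j. j \<in> J \<Longrightarrow> finite (A j)"
  shows "(\<Prod>j\<in>J. card (A j) choose t j) =
    card {M. M \<subseteq> Sigma J A \<and> (\<forall>j\<in>J. card (M `` {j}) = t j)}"
proof -
  have "bij_betw (Sigma J) (\<Pi>\<^sub>E j\<in>J. {B. B \<subseteq> A j \<and> card B = t j})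
      {M. M \<subseteq> Sigma J A \<and> (\<forall>j\<in>J. card (M `` {j}) = t j)}"
  proof (rule bij_betw_byWitness[where f' = "\<lambda>M. restrict (\<lambda>j. M `` {j}) J"])
    show "\<forall>S\<in>\<Pi>\<^sub>E j\<in>J. {B. B \<subseteq> A j \<and> card B = t j}. restrict (\<lambda>j. Sigma J S `` {j}) J = S"
      by (auto simp: fun_eq_iff PiE_def extensional_def Image_singleton)
    show "\<forall>M\<in>{M. M \<subseteq> Sigma J A \<and> (\<forall>j\<in>J. card (M `` {j}) = t j)}.
        Sigma J (restrict (\<lambda>j. M `` {j}) J) = M"
      by auto
    have "Sigma J S `` {j} = S j" if "j \<in> J" for S :: "'j \<Rightarrow> 'a set" and j
      using that by auto
    then show "Sigma J ` (\<Pi>\<^sub>E j\<in>J. {B. B \<subseteq> A j \<and> card B = t j}) \<subseteq>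
        {M. M \<subseteq> Sigma J A \<and> (\<forall>j\<in>J. card (M `` {j}) = t j)}"
      by (fastforce simp: PiE_iff)
    show "(\<lambda>M. restrict (\<lambda>j. M `` {j}) J) `
        {M. M \<subseteq> Sigma J A \<and> (\<forall>j\<in>J. card (M `` {j}) = t j)} \<subseteq>
        (\<Pi>\<^sub>E j\<in>J. {B. B \<subseteq> A j \<and> card B = t j})"
      by auto
  qed
  then show ?thesis
    using assms by (simp add: bij_betw_same_card[symmetric] card_PiE n_subsets)
qed

section \<open>Placing disjoint blocks in an interval\<close>

text \<open>The pair \<open>(j, a)\<close> stands for a block of type \<open>j\<close>, hence of length \<open>q j\<close>, with first point
  \<open>a\<close>.\<close>

definition block :: "('j \<Rightarrow> nat) \<Rightarrow> 'j \<times> nat \<Rightarrow> nat set" where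
  "block q p = {snd p..<snd p + q (fst p)}"

definition placements :: "('j \<Rightarrow> nat) \<Rightarrow> 'j set \<Rightarrow> nat \<Rightarrow> ('j \<Rightarrow> nat) \<Rightarrow> ('j \<times> nat) set set" where
  "placements q J n t = {M. M \<subseteq> J \<times> {1..n} \<and> (\<forall>p\<in>M. block q p \<subseteq> {1..n}) \<and>
     disjoint_family_on (block q) M \<and> (\<forall>j\<in>J. card (M `` {j}) = t j)}"

lemma finite_block [simp]: "finite (block q p)"
  by (simp add: block_def)

lemma finite_placements:
  assumes "finite J"
  shows "finite (placements q J n t)"
proof (rule finite_subset)
  show "placements q J n t \<subseteq> Pow (J \<times> {1..n})"
    unfolding placements_def by blast
  show "finite (Pow (J \<times> {1..n}))"
    using assms by simp
qed

lemma finite_placement: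
  assumes "finite J" and "M \<in> placements q J n t"
  shows "finite M"
proof (rule finite_subset)
  show "M \<subseteq> J \<times> {1..n}"
    using assms(2) by (simp add: placements_def)
  show "finite (J \<times> {1..n})"
    using assms(1) by simp
qed

lemma placementsD:
  assumes "M \<in> placements q J n t" and "p \<in> M"
  shows "fst p \<in> J" and "snd p \<in> {1..n}" and "block q p \<subseteq> {1..n}"
proof -
  have "M \<subseteq> J \<times> {1..n}" and sub: "\<forall>p\<in>M. block q p \<subseteq> {1..n}"
    using assms(1) by (simp_all add: placements_def)
  then have "p \<in> J \<times> {1..n}"
    using assms(2) by blast
  then show "fst p \<in> J" and "snd p \<in> {1..n}"
    by (simp_all add: mem_Times_iff)
  show "block q p \<subseteq> {1..n}"
    using sub assms(2) by blast
qed

lemma placements_same_block: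
  assumes "M \<in> placements q J n t" and "p \<in> M" and "p' \<in> M"
    and "x \<in> block q p" and "x \<in> block q p'"
  shows "p = p'"
proof (rule ccontr)
  assume "p \<noteq> p'"
  moreover have "disjoint_family_on (block q) M"
    using assms(1) by (simp add: placements_def)
  ultimately have "block q p \<inter> block q p' = {}"
    using assms(2,3) by (simp add: disjoint_family_on_def)
  then show False
    using assms(4,5) by blast
qed

lemma card_Union_blocks:
  assumes "finite J" and M: "M \<in> placements q J n t"
  shows "card (\<Union> (block q ` M)) = (\<Sum>j\<in>J. q j * t j)"
proof -
  have fin: "finite M"
    using assms by (rule finite_placement)
  have "card (\<Union> (block q ` M)) = (\<Sum>p\<in>M. card (block q p))"
    using fin M by (intro card_UN_disjoint) (auto simp: placements_def disjoint_family_on_def)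
  also have "\<dots> = (\<Sum>p\<in>Sigma J (\<lambda>j. M `` {j}). card (block q p))"
    using placementsD(1)[OF M] by (intro sum.cong) force+
  also have "\<dots> = (\<Sum>j\<in>J. \<Sum>a\<in>M `` {j}. q j)"
    using \<open>finite J\<close> fin by (subst sum.Sigma) (auto simp: block_def case_prod_beta)
  also have "\<dots> = (\<Sum>j\<in>J. q j * t j)"
    using M by (intro sum.cong) (auto simp: placements_def mult.commute)
  finally show ?thesis .
qed

lemma placements_total_length_le:
  assumes "finite J" and M: "M \<in> placements q J n t"
  shows "(\<Sum>j\<in>J. q j * t j) \<le> n"
proof -
  have "\<Union> (block q ` M) \<subseteq> {1..n}"
    using M by (auto simp: placements_def)
  then have "card (\<Union> (block q ` M)) \<le> n"
    using card_mono[of "{1..n}"] by fastforce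
  then show ?thesis
    using card_Union_blocks[OF assms] by simp
qed

text \<open>The placements in \<open>[n + 1]\<close> are classified by what happens at the last point: either it is
  uncovered, or it is the end of a block of some type \<open>j\<close>, whose removal leaves a placement in
  \<open>[n + 1 - q j]\<close> because every other block, being disjoint from it, lies to its left.  The next
  three lemmas describe these cases, and \<open>card_placements_Suc\<close> is the resulting recursion.\<close>

lemma placement_without_last:
  assumes q: "\<And>j. j \<in> J \<Longrightarrow> 1 \<le> q j"
    and M: "M \<in> placements q J (Suc n) t"
    and last: "Suc n \<notin> \<Union> (block q ` M)"
  shows "M \<in> placements q J n t"
proof -
  have sub: "block q p \<subseteq> {1..n}" if "p \<in> M" for p
  proof
    fix x assume x: "x \<in> block q p"
    then have "x \<in> {1..Suc n}" "x \<noteq> Suc n"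
      using placementsD(3)[OF M that] last that by blast+
    then show "x \<in> {1..n}" by auto
  qed
  have "p \<in> J \<times> {1..n}" if "p \<in> M" for p
  proof -
    have "fst p \<in> J"
      using M that by (auto simp: placements_def)
    then have "snd p \<in> block q p"
      using q[of "fst p"] by (auto simp: block_def)
    with \<open>fst p \<in> J\<close> sub[OF that] show ?thesis
      by (auto simp: mem_Times_iff)
  qed
  with sub M show ?thesis
    by (auto simp: placements_def)
qed

lemma placement_remove_last:
  assumes "finite J" and q: "\<And>j. j \<in> J \<Longrightarrow> 1 \<le> q j"
    and M: "M \<in> placements q J (Suc n) t"
    and p: "(j, a) \<in> M" and last: "Suc n \<in> block q (j, a)"
  shows "j \<in> J" and "0 < t j" and "q j \<le> Suc n" and "a = Suc (Suc n) - q j"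
    and "M - {(j, a)} \<in> placements q J (Suc n - q j) (t(j := t j - 1))"
proof -
  have fin: "finite M"
    using assms(1) M by (rule finite_placement)
  show j: "j \<in> J"
    using M p by (auto simp: placements_def)
  have sub: "block q (j, a) \<subseteq> {1..Suc n}"
    using M p unfolding placements_def by blast
  have a: "1 \<le> a" "a + q j = Suc (Suc n)"
  proof -
    show "1 \<le> a"
      using M p by (auto simp: placements_def)
    have "a + q j - 1 \<in> block q (j, a)"
      using q[OF j] by (auto simp: block_def)
    then have "a + q j - 1 \<le> Suc n"
      using sub by fastforce
    then show "a + q j = Suc (Suc n)"
      using last by (auto simp: block_def)
  qed
  then show "q j \<le> Suc n" and "a = Suc (Suc n) - q j"
    by auto
  have card: "card (M `` {i}) = t i" if "i \<in> J" for i
    using M that by (auto simp: placements_def)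
  have "a \<in> M `` {j}" "finite (M `` {j})"
    using p fin by auto
  then show "0 < t j"
    using card[OF j] card_gt_0_iff[of "M `` {j}"] by auto
  have sub': "block q p \<subseteq> {1..Suc n - q j}" if p': "p \<in> M - {(j, a)}" for p
  proof
    fix x assume x: "x \<in> block q p"
    have "x \<in> {1..Suc n}"
      using placementsD(3)[OF M, of p] p' x by blast
    moreover have "x \<notin> block q (j, a)"
      using placements_same_block[OF M p, of p x] p' x by blast
    ultimately show "x \<in> {1..Suc n - q j}"
      using a by (auto simp: block_def)
  qed
  have "p \<in> J \<times> {1..Suc n - q j}" if p': "p \<in> M - {(j, a)}" for p
  proof -
    have "fst p \<in> J"
      using M p' by (auto simp: placements_def)
    then have "snd p \<in> block q p"
      using q[of "fst p"] by (auto simp: block_def)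
    with \<open>fst p \<in> J\<close> sub'[OF p'] show ?thesis
      by (auto simp: mem_Times_iff)
  qed
  moreover have "card ((M - {(j, a)}) `` {i}) = (t(j := t j - 1)) i" if i: "i \<in> J" for i
  proof (cases "i = j")
    case True
    have "(M - {(j, a)}) `` {j} = M `` {j} - {a}"
      by auto
    then show ?thesis
      using True \<open>a \<in> M `` {j}\<close> card[OF j] by simp
  next
    case False
    then have "(M - {(j, a)}) `` {i} = M `` {i}"
      by auto
    then show ?thesis
      using False card[OF i] by simp
  qed
  moreover have "disjoint_family_on (block q) (M - {(j, a)})"
    using M by (auto simp: placements_def disjoint_family_on_def)
  ultimately show "M - {(j, a)} \<in> placements q J (Suc n - q j) (t(j := t j - 1))"
    using sub' by (auto simp: placements_def)
qed

lemma placement_insert_last: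
  assumes "finite J" and j: "j \<in> J" and "0 < t j" and "1 \<le> q j" and "q j \<le> Suc n"
    and M: "M \<in> placements q J (Suc n - q j) (t(j := t j - 1))"
  defines "p \<equiv> (j, Suc (Suc n) - q j)"
  shows "p \<notin> M" and "insert p M \<in> placements q J (Suc n) t" and "Suc n \<in> block q p"
proof -
  have fin: "finite M"
    using assms(1) M by (rule finite_placement)
  have block_p: "block q p = {Suc (Suc n) - q j..Suc n}"
    using assms(4,5) by (auto simp: block_def p_def)
  then show last: "Suc n \<in> block q p"
    using assms(4) by auto
  have old: "block q p' \<subseteq> {1..Suc n - q j}" if "p' \<in> M" for p'
    using M that by (auto simp: placements_def)
  have disj: "block q p' \<inter> block q p = {}" if "p' \<in> M" for p'
    using old[OF that] \<open>q j \<le> Suc n\<close> unfolding block_p by fastforce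
  show notin: "p \<notin> M"
    using disj last by blast
  have "card (insert p M `` {i}) = t i" if i: "i \<in> J" for i
  proof (cases "i = j")
    case True
    have "insert p M `` {j} = insert (snd p) (M `` {j})"
      by (auto simp: p_def)
    moreover have "snd p \<notin> M `` {j}"
      using notin by (auto simp: p_def)
    moreover have "card (M `` {j}) = t j - 1"
      using M j by (auto simp: placements_def)
    ultimately show ?thesis
      using True \<open>0 < t j\<close> fin by (simp add: finite_Image)
  next
    case False
    then have "insert p M `` {i} = M `` {i}"
      by (auto simp: p_def)
    then show ?thesis
      using False M i by (auto simp: placements_def)
  qed
  moreover have "disjoint_family_on (block q) (insert p M)"
    using M disj by (fastforce simp: placements_def disjoint_family_on_def)
  moreover have "insert p M \<subseteq> J \<times> {1..Suc n}"
    using placementsD[OF M] j assms(4,5) by (fastforce simp: p_def)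
  moreover have "\<forall>p'\<in>insert p M. block q p' \<subseteq> {1..Suc n}"
    using old block_p assms(4,5) by fastforce
  ultimately show "insert p M \<in> placements q J (Suc n) t"
    by (simp add: placements_def)
qed

lemma card_placements_Suc:
  assumes J: "finite J" and q: "\<And>j. j \<in> J \<Longrightarrow> 1 \<le> q j"
  shows "card (placements q J (Suc n) t) = card (placements q J n t) +
    (\<Sum>j\<in>{j\<in>J. 0 < t j \<and> q j \<le> Suc n}. card (placements q J (Suc n - q j) (t(j := t j - 1))))"
proof -
  define I where "I = {j\<in>J. 0 < t j \<and> q j \<le> Suc n}"
  define p where "p j = (j, Suc (Suc n) - q j)" for j
  \<comment> \<open>\<open>p j\<close> is the block of type \<open>j\<close> that ends at \<open>n + 1\<close>, and \<open>E j\<close> is the class of the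
    placements that contain it.\<close>
  define E where "E j = insert (p j) ` placements q J (Suc n - q j) (t(j := t j - 1))" for j
  have I: "j \<in> J" "0 < t j" "1 \<le> q j" "q j \<le> Suc n" if "j \<in> I" for j
    using that q by (auto simp: I_def)
  have ins: "p j \<notin> M" "insert (p j) M \<in> placements q J (Suc n) t" "Suc n \<in> block q (p j)"
    if "j \<in> I" "M \<in> placements q J (Suc n - q j) (t(j := t j - 1))" for j M
    using placement_insert_last[of J j t q n M] J I[OF that(1)] that(2) by (simp_all add: p_def)
  have E_D: "M \<in> placements q J (Suc n) t" "p j \<in> M" "Suc n \<in> block q (p j)"
    if "j \<in> I" "M \<in> E j" for j M
    using that ins by (auto simp: E_def)
  have fin_E: "finite (E j)" for j
    by (simp add: E_def finite_placements[OF J])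
  have card_E: "card (E j) = card (placements q J (Suc n - q j) (t(j := t j - 1)))"
    if j: "j \<in> I" for j
    unfolding E_def using ins(1)[OF j]
    by (intro card_image inj_onI) (metis insert_ident)
  have "finite I"
    using J by (simp add: I_def)
  have split: "placements q J (Suc n) t = placements q J n t \<union> (\<Union>j\<in>I. E j)"
  proof (intro equalityI subsetI)
    fix M assume M: "M \<in> placements q J (Suc n) t"
    show "M \<in> placements q J n t \<union> (\<Union>j\<in>I. E j)"
    proof (cases "Suc n \<in> \<Union> (block q ` M)")
      case True
      then obtain j a where ja: "(j, a) \<in> M" "Suc n \<in> block q (j, a)"
        by auto
      note rem = placement_remove_last[where q = q and J = J, OF J q M ja]
      have "j \<in> I"
        using rem by (auto simp: I_def)
      moreover have "M = insert (p j) (M - {(j, a)})"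
        using ja rem(4) by (auto simp: p_def)
      then have "M \<in> E j"
        using rem(5) unfolding E_def by blast
      ultimately show ?thesis by blast
    next
      case False
      then show ?thesis
        using placement_without_last[where q = q and J = J, OF q M] by blast
    qed
  next
    fix M assume "M \<in> placements q J n t \<union> (\<Union>j\<in>I. E j)"
    moreover have "M \<in> placements q J (Suc n) t" if "M \<in> placements q J n t"
      using that by (fastforce simp: placements_def)
    ultimately show "M \<in> placements q J (Suc n) t"
      using E_D by blast
  qed
  have disj: "placements q J n t \<inter> (\<Union>j\<in>I. E j) = {}"
  proof -
    have "Suc n \<notin> block q p'" if "M \<in> placements q J n t" "p' \<in> M" for M p'
      using that by (force simp: placements_def)
    then show ?thesis
      using E_D by blast
  qed
  have disj_E: "E i \<inter> E j = {}" if "i \<in> I" "j \<in> I" "i \<noteq> j" for i j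
  proof -
    have False if M: "M \<in> E i" "M \<in> E j" for M
    proof -
      have "p i \<noteq> p j"
        using \<open>i \<noteq> j\<close> by (simp add: p_def)
      then show False
        using placements_same_block[of M q J "Suc n" t "p i" "p j" "Suc n"]
          E_D[OF \<open>i \<in> I\<close> M(1)] E_D[OF \<open>j \<in> I\<close> M(2)] by blast
    qed
    then show ?thesis by blast
  qed
  have "card (placements q J (Suc n) t) = card (placements q J n t) + card (\<Union>j\<in>I. E j)"
    unfolding split using J fin_E \<open>finite I\<close> disj
    by (intro card_Un_disjoint) (auto simp: finite_placements)
  also have "card (\<Union>j\<in>I. E j) = (\<Sum>j\<in>I. card (E j))"
    using \<open>finite I\<close> fin_E disj_E by (intro card_UN_disjoint) auto
  also have "\<dots> = (\<Sum>j\<in>I. card (placements q J (Suc n - q j) (t(j := t j - 1))))"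
    by (intro sum.cong card_E) auto
  finally show ?thesis
    by (simp add: I_def)
qed

lemma sum_fun_upd_pred:
  fixes w t :: "'j \<Rightarrow> nat"
  assumes "finite J" and "j \<in> J" and "0 < t j"
  shows "(\<Sum>i\<in>J. w i * t i) = w j + (\<Sum>i\<in>J. w i * (t(j := t j - 1)) i)"
proof -
  have "(\<Sum>i\<in>J - {j}. w i * (t(j := t j - 1)) i) = (\<Sum>i\<in>J - {j}. w i * t i)"
    by (rule sum.cong) auto
  moreover have "w j * t j = w j + w j * (t j - 1)"
    using assms by (cases "t j") auto
  ultimately show ?thesis
    unfolding sum.remove[OF assms(1,2)] by simp
qed

lemma prod_fact_fun_upd_pred:
  fixes t :: "'j \<Rightarrow> nat"
  assumes "finite J" and "j \<in> J" and "0 < t j"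
  shows "(\<Prod>i\<in>J. fact (t i) :: nat) = t j * (\<Prod>i\<in>J. fact ((t(j := t j - 1)) i))"
proof -
  have "(\<Prod>i\<in>J - {j}. fact ((t(j := t j - 1)) i) :: nat) = (\<Prod>i\<in>J - {j}. fact (t i))"
    by (rule prod.cong) auto
  moreover have "(fact (t j) :: nat) = t j * fact (t j - 1)"
    using assms by (simp add: fact_reduce)
  ultimately show ?thesis
    unfolding prod.remove[OF assms(1,2)] by simp
qed

text \<open>The multinomial coefficient, without division and with the number \<open>r\<close> of uncovered
  points as a parameter in place of the length of the interval.  Let \<open>s\<close> be one
  less than the number \<open>r + \<Sum>j. t j\<close> of pieces.  In the recursion \<open>card_placements_Suc\<close>, multiplied
  by \<open>r! \<Prod>j. t j!\<close>, the placements that leave the last point uncovered contribute \<open>r * s!\<close> and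
  those that end with a block of type \<open>j\<close> contribute \<open>t j * s!\<close>.\<close>

lemma card_placements:
  fixes q t :: "'j \<Rightarrow> nat"
  assumes J: "finite J" and q: "\<And>j. j \<in> J \<Longrightarrow> 1 \<le> q j"
  shows "card (placements q J (r + (\<Sum>j\<in>J. q j * t j)) t) * ((\<Prod>j\<in>J. fact (t j)) * fact r) =
    fact (r + (\<Sum>j\<in>J. t j))"
proof (induction "r + (\<Sum>j\<in>J. t j)" arbitrary: r t)
  case 0
  then have t: "r = 0" "\<And>j. j \<in> J \<Longrightarrow> t j = 0"
    using J by auto
  have "placements q J 0 t = {{}}"
    using t by (auto simp: placements_def disjoint_family_on_def)
  then show ?case
    using t by simp
next
  case (Suc s)
  let ?F = "\<lambda>t. \<Prod>j\<in>J. fact (t j) :: nat"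
  let ?L = "\<lambda>t. \<Sum>j\<in>J. q j * t j"
  let ?t = "\<lambda>j. t(j := t j - 1)"
  have "(\<Sum>j\<in>J. t j) \<le> ?L t"
    using q by (intro sum_mono) auto
  then obtain n where n: "r + ?L t = Suc n"
    using Suc.hyps(2) by (cases "r + ?L t") auto
  \<comment> \<open>For \<open>r = 0\<close> both sides vanish, as the blocks have total length \<open>n + 1\<close>.\<close>
  have free: "card (placements q J n t) * (?F t * fact r) = r * fact s"
  proof (cases r)
    case 0
    then have "placements q J n t = {}"
      using placements_total_length_le[OF J] n by fastforce
    then show ?thesis
      using 0 by simp
  next
    case r: (Suc r')
    then have "card (placements q J n t) * (?F t * fact r') = fact s"
      using Suc.hyps(1)[of r' t] Suc.hyps(2) n by simp
    then show ?thesis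
      using r by (simp add: algebra_simps)
  qed
  have covered: "card (placements q J (Suc n - q j) (?t j)) * (?F t * fact r) = t j * fact s"
    if j: "j \<in> J" "0 < t j" for j
  proof -
    have "?L t = q j + ?L (?t j)"
      using J j by (rule sum_fun_upd_pred)
    then have "Suc n - q j = r + ?L (?t j)"
      using n by simp
    moreover have "s = r + (\<Sum>i\<in>J. ?t j i)"
      using sum_fun_upd_pred[of J j t "\<lambda>_. 1"] J j Suc.hyps(2) by simp
    ultimately have "fact s = card (placements q J (Suc n - q j) (?t j)) * (?F (?t j) * fact r)"
      using Suc.hyps(1)[of r "?t j"] by simp
    then have "t j * fact s =
        card (placements q J (Suc n - q j) (?t j)) * (t j * ?F (?t j) * fact r)"
      by (simp only: mult_ac)
    then show ?thesis
      by (simp only: prod_fact_fun_upd_pred[where t = t and j = j, OF J j])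
  qed
  have fits: "q j \<le> Suc n" if j: "j \<in> J" "0 < t j" for j
    using sum_fun_upd_pred[where t = t and j = j and w = q, OF J j] n by linarith
  have rec: "card (placements q J (Suc n) t) = card (placements q J n t) +
      (\<Sum>j\<in>{j\<in>J. 0 < t j \<and> q j \<le> Suc n}. card (placements q J (Suc n - q j) (?t j)))"
    using J q by (rule card_placements_Suc)
  have "card (placements q J (r + ?L t) t) * (?F t * fact r) =
      card (placements q J n t) * (?F t * fact r) +
      (\<Sum>j\<in>{j\<in>J. 0 < t j \<and> q j \<le> Suc n}.
        card (placements q J (Suc n - q j) (?t j)) * (?F t * fact r))"
    unfolding n rec add_mult_distrib sum_distrib_right ..
  also have "\<dots> = r * fact s + (\<Sum>j\<in>{j\<in>J. 0 < t j \<and> q j \<le> Suc n}. t j * fact s)"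
    using free covered by simp
  \<comment> \<open>Every type that is used fits, so only types with \<open>t j = 0\<close> are missing from the sum.\<close>
  also have "(\<Sum>j\<in>{j\<in>J. 0 < t j \<and> q j \<le> Suc n}. t j * fact s) = (\<Sum>j\<in>J. t j * fact s)"
    using J fits by (intro sum.mono_neutral_left) auto
  also have "r * fact s + \<dots> = (r + (\<Sum>j\<in>J. t j)) * fact s"
    by (simp add: add_mult_distrib sum_distrib_right)
  also have "\<dots> = fact (r + (\<Sum>j\<in>J. t j))"
    using Suc.hyps(2) by (metis fact_Suc of_nat_id)
  finally show ?case .
qed

section \<open>Permutations containing given adjacent cycles\<close>

text \<open>Extend \<open>g\<close> by the identity to a permutation \<open>h\<close>.  Composition with \<open>h\<close> turns the
  permutations that agree with \<open>g\<close> on \<open>U\<close> into those that fix \<open>U\<close> pointwise, that is, into the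
  permutations of \<open>A - U\<close>.\<close>

lemma card_permutes_extending:
  assumes "finite A" and "U \<subseteq> A" and g: "bij_betw g U U"
  shows "card {\<pi>. \<pi> permutes A \<and> (\<forall>x\<in>U. \<pi> x = g x)} = fact (card A - card U)"
proof -
  define h where "h x = (if x \<in> U then g x else x)" for x
  have "bij_betw h U U"
    using g by (subst bij_betw_cong[of U h g]) (auto simp: h_def)
  then have h: "h permutes U"
    by (rule bij_imp_permutes) (simp add: h_def)
  have hA: "h permutes A"
    using h \<open>U \<subseteq> A\<close> by (rule permutes_subset)
  have "bij_betw (\<lambda>\<sigma>. h \<circ> \<sigma>) {\<sigma>. \<sigma> permutes A - U} {\<pi>. \<pi> permutes A \<and> (\<forall>x\<in>U. \<pi> x = g x)}"
  proof (rule bij_betw_byWitness[where f' = "\<lambda>\<pi>. inv h \<circ> \<pi>"])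
    show "\<forall>\<sigma>\<in>{\<sigma>. \<sigma> permutes A - U}. inv h \<circ> (h \<circ> \<sigma>) = \<sigma>"
      using permutes_inv_o[OF h] by (simp flip: comp_assoc)
    show "\<forall>\<pi>\<in>{\<pi>. \<pi> permutes A \<and> (\<forall>x\<in>U. \<pi> x = g x)}. h \<circ> (inv h \<circ> \<pi>) = \<pi>"
      using permutes_inv_o[OF h] by (simp flip: comp_assoc)
    show "(\<lambda>\<sigma>. h \<circ> \<sigma>) ` {\<sigma>. \<sigma> permutes A - U} \<subseteq>
        {\<pi>. \<pi> permutes A \<and> (\<forall>x\<in>U. \<pi> x = g x)}"
    proof safe
      fix \<sigma> assume \<sigma>: "\<sigma> permutes A - U"
      then have "\<sigma> permutes A"
        by (rule permutes_subset) auto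
      then show "h \<circ> \<sigma> permutes A"
        using hA by (rule permutes_compose)
      show "(h \<circ> \<sigma>) x = g x" if "x \<in> U" for x
        using permutes_not_in[OF \<sigma>, of x] that by (simp add: h_def)
    qed
    show "(\<lambda>\<pi>. inv h \<circ> \<pi>) ` {\<pi>. \<pi> permutes A \<and> (\<forall>x\<in>U. \<pi> x = g x)} \<subseteq>
        {\<sigma>. \<sigma> permutes A - U}"
    proof safe
      fix \<pi> assume \<pi>: "\<pi> permutes A" "\<forall>x\<in>U. \<pi> x = g x"
      have "(inv h \<circ> \<pi>) x = x" if "x \<in> U" for x
      proof -
        have "\<pi> x = h x"
          using that \<pi>(2) by (simp add: h_def)
        then show ?thesis
          using permutes_inverses(2)[OF h] by simp
      qed
      then show "inv h \<circ> \<pi> permutes A - U"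
        using permutes_compose[OF \<pi>(1) permutes_inv[OF hA]] by (auto intro: permutes_superset)
    qed
  qed
  then have "card {\<pi>. \<pi> permutes A \<and> (\<forall>x\<in>U. \<pi> x = g x)} = card {\<sigma>. \<sigma> permutes A - U}"
    by (simp add: bij_betw_same_card)
  also have "\<dots> = fact (card A - card U)"
    using assms(1,2) by (simp add: card_permutations card_Diff_subset finite_subset)
  finally show ?thesis .
qed

text \<open>On the points of the block \<open>p\<close> this is the action of the adjacent cycle supported there.\<close>

definition rotate_block :: "('j \<Rightarrow> nat) \<Rightarrow> 'j \<times> nat \<Rightarrow> nat \<Rightarrow> nat" where
  "rotate_block q p x = (if Suc x = snd p + q (fst p) then snd p else Suc x)"

lemma rotate_block_image:
  assumes "1 \<le> q (fst p)"
  shows "rotate_block q p ` block q p = block q p"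
proof
  show "rotate_block q p ` block q p \<subseteq> block q p"
    using assms by (auto simp: rotate_block_def block_def)
  show "block q p \<subseteq> rotate_block q p ` block q p"
  proof
    fix x assume x: "x \<in> block q p"
    show "x \<in> rotate_block q p ` block q p"
    proof (cases "x = snd p")
      case True
      then show ?thesis
        using assms
        by (intro image_eqI[of _ _ "snd p + q (fst p) - 1"]) (auto simp: rotate_block_def block_def)
    next
      case False
      then show ?thesis
        using x by (intro image_eqI[of _ _ "x - 1"]) (auto simp: rotate_block_def block_def)
    qed
  qed
qed

lemma adjacent_cycle_at_iff_rotate_block:
  assumes "1 \<le> q j"
  shows "adjacent_cycle_at n (q j) \<pi> a \<longleftrightarrow>
    1 \<le> a \<and> block q (j, a) \<subseteq> {1..n} \<and> (\<forall>x\<in>block q (j, a). \<pi> x = rotate_block q (j, a) x)"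
    (is "_ \<longleftrightarrow> _ \<and> _ \<and> ?rot")
proof -
  have "?rot \<longleftrightarrow> (\<forall>i. i + 2 \<le> q j \<longrightarrow> \<pi> (a + i) = a + i + 1) \<and> \<pi> (a + q j - 1) = a"
  proof
    assume rot: ?rot
    have "\<pi> (a + i) = a + i + 1" if "i + 2 \<le> q j" for i
      using that bspec[OF rot, of "a + i"] by (auto simp: block_def rotate_block_def)
    moreover have "\<pi> (a + q j - 1) = a"
      using assms bspec[OF rot, of "a + q j - 1"] by (auto simp: block_def rotate_block_def)
    ultimately show "(\<forall>i. i + 2 \<le> q j \<longrightarrow> \<pi> (a + i) = a + i + 1) \<and> \<pi> (a + q j - 1) = a"
      by blast
  next
    assume cyc: "(\<forall>i. i + 2 \<le> q j \<longrightarrow> \<pi> (a + i) = a + i + 1) \<and> \<pi> (a + q j - 1) = a"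
    show ?rot
    proof
      fix x assume "x \<in> block q (j, a)"
      then obtain i where i: "x = a + i" "i < q j"
        by (auto simp: block_def dest: le_Suc_ex)
      show "\<pi> x = rotate_block q (j, a) x"
      proof (cases "Suc i = q j")
        case True
        then have "x = a + q j - 1"
          using i by simp
        then show ?thesis
          using cyc True i by (simp add: rotate_block_def)
      next
        case False
        then show ?thesis
          using cyc i by (simp add: rotate_block_def)
      qed
    qed
  qed
  moreover have "a + q j - 1 \<le> n \<longleftrightarrow> block q (j, a) \<subseteq> {1..n}" if "1 \<le> a"
    using assms that by (auto simp: block_def subset_iff)
  ultimately show ?thesis
    unfolding adjacent_cycle_at_def by blast
qed

text \<open>Because the blocks are disjoint, their cyclic shifts have a common extension \<open>g\<close> to the union
  \<open>U\<close> of the blocks.  It maps each block onto itself, so it is a bijection of \<open>U\<close>, and containing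
  all the cycles means agreeing with \<open>g\<close> on \<open>U\<close>.\<close>

lemma card_permutes_containing_placement:
  assumes J: "finite J" and q: "\<And>j. j \<in> J \<Longrightarrow> 1 \<le> q j"
    and M: "M \<in> placements q J n t"
  shows "card {\<pi>. \<pi> permutes {1..n} \<and> (\<forall>(j, a)\<in>M. adjacent_cycle_at n (q j) \<pi> a)} =
    fact (n - (\<Sum>j\<in>J. q j * t j))"
proof -
  define U where "U = \<Union> (block q ` M)"
  note M_D = placementsD[OF M]
  have "\<forall>x\<in>U. \<exists>y. \<forall>p\<in>M. x \<in> block q p \<longrightarrow> y = rotate_block q p x"
  proof
    fix x assume "x \<in> U"
    then obtain p where "p \<in> M" "x \<in> block q p"
      by (auto simp: U_def)
    then have "\<forall>p'\<in>M. x \<in> block q p' \<longrightarrow> rotate_block q p x = rotate_block q p' x"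
      using placements_same_block[OF M] by blast
    then show "\<exists>y. \<forall>p\<in>M. x \<in> block q p \<longrightarrow> y = rotate_block q p x"
      by blast
  qed
  then obtain g where "\<forall>x\<in>U. \<forall>p\<in>M. x \<in> block q p \<longrightarrow> g x = rotate_block q p x"
    by (auto dest!: bchoice)
  then have g: "g x = rotate_block q p x" if "p \<in> M" "x \<in> block q p" for p x
    using that by (auto simp: U_def)
  have "g ` block q p = block q p" if "p \<in> M" for p
    using rotate_block_image[of q p] q M_D(1)[OF that] g[OF that] by (simp cong: image_cong)
  then have "g ` U = U"
    by (simp add: U_def image_UN)
  moreover have U: "U \<subseteq> {1..n}"
    using M_D(3) unfolding U_def by blast
  then have "finite U"
    by (rule finite_subset) simp
  ultimately have bij: "bij_betw g U U"
    by (simp add: bij_betw_def eq_card_imp_inj_on)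
  have "(\<forall>(j, a)\<in>M. adjacent_cycle_at n (q j) \<pi> a) \<longleftrightarrow> (\<forall>x\<in>U. \<pi> x = g x)" for \<pi>
  proof -
    have "(\<forall>(j, a)\<in>M. adjacent_cycle_at n (q j) \<pi> a) \<longleftrightarrow>
        (\<forall>p\<in>M. \<forall>x\<in>block q p. \<pi> x = rotate_block q p x)"
    proof (rule ball_cong)
      fix p assume p: "p \<in> M"
      show "(case p of (j, a) \<Rightarrow> adjacent_cycle_at n (q j) \<pi> a) \<longleftrightarrow>
          (\<forall>x\<in>block q p. \<pi> x = rotate_block q p x)"
        using adjacent_cycle_at_iff_rotate_block[of q "fst p" n \<pi> "snd p"] q M_D[OF p]
        by (simp add: case_prod_beta)
    qed simp
    then show ?thesis
      using g by (auto simp: U_def)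
  qed
  then have "card {\<pi>. \<pi> permutes {1..n} \<and> (\<forall>(j, a)\<in>M. adjacent_cycle_at n (q j) \<pi> a)} =
      card {\<pi>. \<pi> permutes {1..n} \<and> (\<forall>x\<in>U. \<pi> x = g x)}"
    by simp
  also have "\<dots> = fact (n - card U)"
    using card_permutes_extending[OF _ U bij] by simp
  also have "card U = (\<Sum>j\<in>J. q j * t j)"
    unfolding U_def using J M by (rule card_Union_blocks)
  finally show ?thesis .
qed

text \<open>Suppose that the block of a cycle starting at \<open>b\<close> meets the block of a cycle starting at
  \<open>a < b\<close>.  Then \<open>b\<close> lies in the latter, so both \<open>b - 1\<close> and the last point of the block of \<open>b\<close>
  are mapped to \<open>b\<close>, against injectivity.  Hence the starting points agree; with different lengths,
  the last point of the shorter block would have to be mapped both to \<open>a\<close> and to its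
  successor.\<close>

lemma adjacent_cycle_blocks_disjoint:
  assumes \<pi>: "\<pi> permutes {1..n}"
    and q: "1 \<le> q i" "1 \<le> q j"
    and cyc: "adjacent_cycle_at n (q i) \<pi> a" "adjacent_cycle_at n (q j) \<pi> b"
    and x: "x \<in> block q (i, a)" "x \<in> block q (j, b)"
  shows "a = b \<and> q i = q j"
proof -
  have inj: "inj \<pi>"
    using \<pi> by (rule permutes_inj)
  \<comment> \<open>Stated for arbitrary positions and types, because the two cycles may occur in either order.\<close>
  have start: False
    if "1 \<le> q i" "1 \<le> q j" "adjacent_cycle_at n (q i) \<pi> a" "adjacent_cycle_at n (q j) \<pi> b"
      "a < b" "b < a + q i" for a b i j
  proof -
    have "\<forall>l. l + 2 \<le> q i \<longrightarrow> \<pi> (a + l) = a + l + 1"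
      using that by (simp add: adjacent_cycle_at_def)
    then have "b - a - 1 + 2 \<le> q i \<longrightarrow> \<pi> (a + (b - a - 1)) = a + (b - a - 1) + 1"
      by (rule spec)
    then have "\<pi> (b - 1) = b"
      using that by simp
    moreover have "\<pi> (b + q j - 1) = b"
      using that by (simp add: adjacent_cycle_at_def)
    ultimately have "b - 1 = b + q j - 1"
      using inj by (metis injD)
    then show False
      using that by simp
  qed
  have len: False
    if "1 \<le> q i" "adjacent_cycle_at n (q i) \<pi> a" "adjacent_cycle_at n (q j) \<pi> a" "q i < q j"
    for a i j
  proof -
    have "\<forall>l. l + 2 \<le> q j \<longrightarrow> \<pi> (a + l) = a + l + 1"
      using that by (simp add: adjacent_cycle_at_def)
    then have "q i - 1 + 2 \<le> q j \<longrightarrow> \<pi> (a + (q i - 1)) = a + (q i - 1) + 1"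
      by (rule spec)
    moreover have "\<pi> (a + q i - 1) = a"
      using that by (simp add: adjacent_cycle_at_def)
    ultimately show False
      using that by simp
  qed
  have "\<not> a < b" "\<not> b < a"
    using start[OF q cyc] start[OF q(2,1) cyc(2,1)] x by (auto simp: block_def)
  then have "a = b" by simp
  moreover have "\<not> q i < q j" "\<not> q j < q i"
    using len[OF q(1) cyc(1)] len[OF q(2) cyc(2)] cyc \<open>a = b\<close> by auto
  ultimately show ?thesis by simp
qed

section \<open>Binomial moments of the numbers of adjacent cycles\<close>

lemma finite_adjacent_cycles:
  assumes "1 \<le> l"
  shows "{a. adjacent_cycle_at n l \<pi> a} \<subseteq> {1..n}" and "finite {a. adjacent_cycle_at n l \<pi> a}"
proof -
  show "{a. adjacent_cycle_at n l \<pi> a} \<subseteq> {1..n}"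
    using assms by (auto simp: adjacent_cycle_at_def)
  then show "finite {a. adjacent_cycle_at n l \<pi> a}"
    by (rule finite_subset) simp
qed

lemma num_adjacent_cycles_le:
  assumes "1 \<le> l"
  shows "num_adjacent_cycles n l \<pi> \<le> n"
  using card_mono[OF _ finite_adjacent_cycles(1)[OF assms]]
  unfolding num_adjacent_cycles_def by fastforce

text \<open>Disjointness of the marked blocks is automatic here.  Injectivity of \<open>q\<close> enters because a
  cycle that belonged to two types could be marked twice, giving two overlapping blocks.\<close>

lemma prod_choose_num_adjacent_cycles:
  assumes J: "finite J" and q: "\<And>j. j \<in> J \<Longrightarrow> 1 \<le> q j" and inj: "inj_on q J"
    and \<pi>: "\<pi> permutes {1..n}"
  shows "(\<Prod>j\<in>J. num_adjacent_cycles n (q j) \<pi> choose t j) =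
    card {M \<in> placements q J n t. \<forall>(j, a)\<in>M. adjacent_cycle_at n (q j) \<pi> a}"
proof -
  define A where "A j = {a. adjacent_cycle_at n (q j) \<pi> a}" for j
  have "{M. M \<subseteq> Sigma J A \<and> (\<forall>j\<in>J. card (M `` {j}) = t j)} =
      {M \<in> placements q J n t. \<forall>(j, a)\<in>M. adjacent_cycle_at n (q j) \<pi> a}" (is "?L = ?R")
  proof (intro equalityI subsetI)
    fix M assume "M \<in> ?L"
    then have M: "M \<subseteq> Sigma J A" "\<forall>j\<in>J. card (M `` {j}) = t j"
      by auto
    have M_D: "fst p \<in> J" "adjacent_cycle_at n (q (fst p)) \<pi> (snd p)" if "p \<in> M" for p
      using M that by (auto simp: A_def)
    have "disjoint_family_on (block q) M"
      unfolding disjoint_family_on_def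
    proof (intro ballI impI, rule ccontr)
      fix p p' assume p: "p \<in> M" "p' \<in> M" "p \<noteq> p'" and "block q p \<inter> block q p' \<noteq> {}"
      then obtain x where "x \<in> block q p" "x \<in> block q p'"
        by blast
      then have "snd p = snd p' \<and> q (fst p) = q (fst p')"
        using adjacent_cycle_blocks_disjoint[OF \<pi>, of q "fst p" "fst p'" "snd p" "snd p'" x]
          q M_D p by simp
      then show False
        using inj_on_eq_iff[OF inj M_D(1) M_D(1), OF p(1,2)] p(3) by (simp add: prod_eq_iff)
    qed
    moreover have "p \<in> J \<times> {1..n}" if "p \<in> M" for p
      using M_D[OF that] finite_adjacent_cycles(1)[OF q, of "fst p" n \<pi>] by (auto simp: mem_Times_iff)
    moreover have "block q p \<subseteq> {1..n}" if "p \<in> M" for p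
      using M_D[OF that] adjacent_cycle_at_iff_rotate_block[of q "fst p" n \<pi> "snd p"] q by simp
    ultimately show "M \<in> ?R"
      using M by (auto simp: placements_def A_def)
  next
    fix M assume "M \<in> ?R"
    then show "M \<in> ?L"
      by (auto simp: placements_def A_def)
  qed
  then show ?thesis
    using prod_choose_eq_card[of J A t] J q finite_adjacent_cycles(2)
    by (simp add: A_def num_adjacent_cycles_def)
qed

text \<open>Count the pairs of a permutation and a placement contained in it, once by permutations and
  once by placements.  When the blocks are too long for \<open>[n]\<close> there are no placements.\<close>

lemma sum_prod_choose_num_adjacent_cycles:
  assumes J: "finite J" and q: "\<And>j. j \<in> J \<Longrightarrow> 1 \<le> q j" and inj: "inj_on q J"
  shows "(\<Sum>\<pi>\<in>{\<pi>. \<pi> permutes {1..n}}. \<Prod>j\<in>J. real (num_adjacent_cycles n (q j) \<pi> choose t j)) =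
    (if (\<Sum>j\<in>J. q j * t j) \<le> n
     then fact (n - (\<Sum>j\<in>J. (q j - 1) * t j)) / (\<Prod>j\<in>J. fact (t j)) else 0)"
proof -
  let ?P = "{\<pi>. \<pi> permutes {1..n}}"
  let ?L = "\<Sum>j\<in>J. q j * t j"
  have "(\<Sum>\<pi>\<in>?P. \<Prod>j\<in>J. num_adjacent_cycles n (q j) \<pi> choose t j) =
      (\<Sum>\<pi>\<in>?P. card {M \<in> placements q J n t. \<forall>(j, a)\<in>M. adjacent_cycle_at n (q j) \<pi> a})"
    using prod_choose_num_adjacent_cycles[where q = q and J = J, OF J q inj] by (intro sum.cong) auto
  also have "\<dots> = (\<Sum>M\<in>placements q J n t. fact (n - ?L))"
    using card_permutes_containing_placement[where q = q and J = J, OF J q]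
    by (intro sum_multicount_gen) (auto simp: finite_permutations finite_placements J)
  finally have count: "(\<Sum>\<pi>\<in>?P. \<Prod>j\<in>J. num_adjacent_cycles n (q j) \<pi> choose t j) =
      card (placements q J n t) * fact (n - ?L)"
    by simp
  have "card (placements q J n t) * fact (n - ?L) =
      (if ?L \<le> n then fact (n - (\<Sum>j\<in>J. (q j - 1) * t j)) / (\<Prod>j\<in>J. fact (t j)) else (0::real))"
  proof (cases "?L \<le> n")
    case True
    have "?L = (\<Sum>j\<in>J. (q j - 1) * t j) + (\<Sum>j\<in>J. t j)"
    proof -
      have "q j * t j = (q j - 1) * t j + t j" if "j \<in> J" for j
        using q[OF that] by (cases "q j") auto
      then show ?thesis
        by (simp flip: sum.distrib)
    qed
    then have "n - ?L + (\<Sum>j\<in>J. t j) = n - (\<Sum>j\<in>J. (q j - 1) * t j)"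
      using True by simp
    then have "card (placements q J n t) * ((\<Prod>j\<in>J. fact (t j)) * fact (n - ?L)) =
        fact (n - (\<Sum>j\<in>J. (q j - 1) * t j))"
      using card_placements[where q = q and J = J, OF J q, of "n - ?L" t] True by simp
    then have "real (card (placements q J n t) * ((\<Prod>j\<in>J. fact (t j)) * fact (n - ?L))) =
        real (fact (n - (\<Sum>j\<in>J. (q j - 1) * t j)))"
      by (rule arg_cong)
    then show ?thesis
      using True J by (simp add: field_simps)
  next
    case False
    then have "placements q J n t = {}"
      using placements_total_length_le[OF J] by blast
    then show ?thesis
      using False by simp
  qed
  then show ?thesis
    using arg_cong[OF count, of real] by simp
qed

section \<open>The number of permutations with given numbers of adjacent cycles\<close>

theorem theorem5p1:
  fixes m n :: nat and q k :: "nat \<Rightarrow> nat"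
  assumes "1 \<le> m"
    and "1 \<le> q 1"
    and "strict_mono_on {1..m} q"
  shows "real (num_perms_adjacent_cycles m q n k) =
    (\<Sum>t\<in>weighted_tuples m q n.
       (-1) ^ (\<Sum>j=1..m. k j + t j) *
       (\<Prod>j=1..m. real (t j choose k j)) *
       (fact (n - (\<Sum>j=1..m. (q j - 1) * t j)) / (\<Prod>j=1..m. fact (t j))))"
proof -
  let ?J = "{1..m}"
  let ?P = "{\<pi>. \<pi> permutes {1..n}}"
  let ?T = "?J \<rightarrow>\<^sub>E {..n}"
  let ?c = "\<lambda>\<pi> j. num_adjacent_cycles n (q j) \<pi>"
  let ?s = "\<lambda>t. (- 1 :: real) ^ (\<Sum>j\<in>?J. k j + t j) * (\<Prod>j\<in>?J. real (t j choose k j))"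
  have inj: "inj_on q ?J"
    using assms(3) by (rule strict_mono_on_imp_inj_on)
  have q: "1 \<le> q j" if "j \<in> ?J" for j
  proof -
    have "q 1 \<le> q j"
      using strict_mono_on_leD[OF assms(3), of 1 j] that by auto
    then show ?thesis
      using assms(2) by simp
  qed
  have fin: "finite ?P"
    by (simp add: finite_permutations)
  \<comment> \<open>Each of the counts is at most \<open>n\<close>, so summing every \<open>t j\<close> up to \<open>n\<close> suffices for all
    permutations.\<close>
  have indicator: "(if \<forall>j\<in>?J. ?c \<pi> j = k j then 1 else 0 :: real) =
      (\<Sum>t\<in>?T. ?s t * (\<Prod>j\<in>?J. real (?c \<pi> j choose t j)))" for \<pi>
  proof -
    have "(if \<forall>j\<in>?J. ?c \<pi> j = k j then 1 else 0 :: real) = (\<Prod>j\<in>?J. if ?c \<pi> j = k j then 1 else 0)"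
      by (auto simp: prod_zero_iff)
    also have "\<dots> = (\<Prod>j\<in>?J. \<Sum>t\<le>n. (- 1) ^ (k j + t) * real (t choose k j) * real (?c \<pi> j choose t))"
      using binomial_inversion_indicator num_adjacent_cycles_le q by (intro prod.cong) auto
    also have "\<dots> = (\<Sum>t\<in>?T. \<Prod>j\<in>?J.
        (- 1) ^ (k j + t j) * real (t j choose k j) * real (?c \<pi> j choose t j))"
      by (rule prod_sum_PiE) auto
    also have "\<dots> = (\<Sum>t\<in>?T. ?s t * (\<Prod>j\<in>?J. real (?c \<pi> j choose t j)))"
      by (simp only: prod.distrib power_sum)
    finally show ?thesis .
  qed
  have "real (num_perms_adjacent_cycles m q n k) =
      (\<Sum>\<pi>\<in>?P. if \<forall>j\<in>?J. ?c \<pi> j = k j then 1 else 0)"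
    using fin by (simp add: num_perms_adjacent_cycles_def sum.If_cases Int_def)
  also have "\<dots> = (\<Sum>\<pi>\<in>?P. \<Sum>t\<in>?T. ?s t * (\<Prod>j\<in>?J. real (?c \<pi> j choose t j)))"
    by (simp only: indicator)
  also have "\<dots> = (\<Sum>t\<in>?T. ?s t * (\<Sum>\<pi>\<in>?P. \<Prod>j\<in>?J. real (?c \<pi> j choose t j)))"
    by (subst sum.swap) (simp only: sum_distrib_left)
  also have "\<dots> = (\<Sum>t\<in>?T. ?s t * (if (\<Sum>j\<in>?J. q j * t j) \<le> n
      then fact (n - (\<Sum>j\<in>?J. (q j - 1) * t j)) / (\<Prod>j\<in>?J. fact (t j)) else 0))"
    using sum_prod_choose_num_adjacent_cycles[where q = q and J = ?J, OF _ q inj] by simp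
  \<comment> \<open>The moments vanish outside the range of summation of the theorem.\<close>
  also have "\<dots> = (\<Sum>t\<in>weighted_tuples m q n. ?s t * (if (\<Sum>j\<in>?J. q j * t j) \<le> n
      then fact (n - (\<Sum>j\<in>?J. (q j - 1) * t j)) / (\<Prod>j\<in>?J. fact (t j)) else 0))"
  proof (rule sum.mono_neutral_right)
    show "finite ?T"
      by (simp add: finite_PiE)
    show "weighted_tuples m q n \<subseteq> ?T"
    proof
      fix t assume t: "t \<in> weighted_tuples m q n"
      have "t j \<le> n" if j: "j \<in> ?J" for j
      proof -
        have "t j \<le> q j * t j"
          using q[OF j] by simp
        also have "\<dots> \<le> (\<Sum>j\<in>?J. q j * t j)"
          using j by (intro member_le_sum) auto
        also have "\<dots> \<le> n"
          using t by (simp add: weighted_tuples_def)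
        finally show ?thesis .
      qed
      then show "t \<in> ?T"
        using t by (auto simp: weighted_tuples_def PiE_iff)
    qed
    show "\<forall>t\<in>?T - weighted_tuples m q n. ?s t * (if (\<Sum>j\<in>?J. q j * t j) \<le> n
      then fact (n - (\<Sum>j\<in>?J. (q j - 1) * t j)) / (\<Prod>j\<in>?J. fact (t j)) else 0) = 0"
    proof
      fix t assume "t \<in> ?T - weighted_tuples m q n"
      then have "\<not> (\<Sum>j\<in>?J. q j * t j) \<le> n"
        by (simp add: weighted_tuples_def PiE_iff)
      then show "?s t * (if (\<Sum>j\<in>?J. q j * t j) \<le> n
          then fact (n - (\<Sum>j\<in>?J. (q j - 1) * t j)) / (\<Prod>j\<in>?J. fact (t j)) else 0) = 0"
        by (simp only: if_False mult_zero_right)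
    qed
  qed
  also have "\<dots> = (\<Sum>t\<in>weighted_tuples m q n. ?s t *
      (fact (n - (\<Sum>j\<in>?J. (q j - 1) * t j)) / (\<Prod>j\<in>?J. fact (t j))))"
    by (rule sum.cong) (simp_all add: weighted_tuples_def)
  finally show ?thesis .
qed

end
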